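(* Suppose $F\in\mathcal{H}_2$ is Lipschitz continuous with Lipschitz constant $L>1$, let $\epsilon>0$, let $\eta,R>0$ satisfy $\eta L\le R\le\epsilon$, and let $n\in\mathbb{N}$. Further, assume that $c>0$ is such that $$\mathrm{d}_{\mathrm{H}}(K_k(F),\varrho(F))\le\frac{c}{k}\quad\text{for all } k\in\mathbb{N}.$$ Then $$\mathrm{d}_{\mathrm{H}}(Q_n^*,\varrho(F))\ \le\ \max\left\{\frac{2\sqrt2}{n},\ \frac{\sqrt2}{n}+\gamma_{\epsilon,n}\right\},$$ where $$\gamma_{\epsilon,n}=\frac{2r_n}{n}(M+\epsilon)+\left(1-\frac{r_n}{n}\right)\min_{1\le k\le n}\frac1k\left(c+2\epsilon\,\frac{L^k-1}{L-1}\right),$$ $M=\max_{x\in[0,1]^2}\|F(x)-x\|$, $k_n$ is the number between $1$ and $n$ for which the minimum on the right is attained, and $r_n=n \bmod k_n$. Here $Q_n^*$ is the output of the box algorithm described in the context, run with the parameters $\epsilon,\eta,R$.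
   Context: $\mathbb{T}^2=\mathbb{R}^2/\mathbb{Z}^2$, and $\mathcal{H}_2$ is the set of all lifts $F:\mathbb{R}^2\to\mathbb{R}^2$ of homeomorphisms of $\mathbb{T}^2$ homotopic to the identity; equivalently, $F$ is a homeomorphism of $\mathbb{R}^2$ with $F(x+k)=F(x)+k$ for all $x\in\mathbb{R}^2$, $k\in\mathbb{Z}^2$. $d$ is the Euclidean distance (and $d(x,B)$ the distance from a point to a set), and $\mathrm{d}_{\mathrm{H}}$ is the Hausdorff distance of subsets of $\mathbb{R}^2$. Rotation set: $\varrho(F)$ is the set of all $v\in\mathbb{R}^2$ for which there exist integers $n_i\nearrow\infty$ and points $x_i\in\mathbb{R}^2$ with $\lim_{i\to\infty}\frac{F^{n_i}(x_i)-x_i}{n_i}=v$. For $k\in\mathbb{N}$, $K_k(F)=\left\{\frac{F^k(x)-x}{k} : x\in[0,1]^2\right\}$. Box algorithm with parameters $\epsilon,\eta,R>0$: let $\mathcal{B}_0$ be a collection of compact sets (boxes) $B\subset[0,1]^2$ with $\sup_{B\in\mathcal{B}_0}\mathrm{diam}(B)\le\epsilon$ and $\bigcup_{B\in\mathcal{B}_0}B=[0,1]^2$. Let $\mathcal{B}=\{B+t : B\in\mathcal{B}_0,\ t\in\mathbb{Z}^2\}$. For each $B\in\mathcal{B}$ let $\Gamma_B\subseteq B$ be a finite set that is $\eta$-dense in $B$ (every point of $B$ is within distance $\eta$ of some point of $\Gamma_B$), chosen such that $\Gamma_{B+t}=\Gamma_B+t$ for every $t\in\mathbb{Z}^2$.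 For $B\in\mathcal{B}$ define the box image $\mathcal{I}(B)=\{B'\in\mathcal{B} : \exists x\in\Gamma_B \text{ with } d(F(x),B')\le R\}$. Put $Q_0=[0,1]^2$ and, for $k\ge0$, $\mathcal{B}_{k+1}=\{B'\in\mathcal{B} : \exists B\in\mathcal{B}_k \text{ with } B'\in\mathcal{I}(B)\}$ and $Q_{k+1}=\bigcup_{B\in\mathcal{B}_{k+1}}B$. Finally $Q_n^*=\frac1n Q_n$ for $n\in\mathbb{N}$. *)

theory Defs
  imports "HOL-Analysis.Analysis"
begin

definition integer_points :: "(real^2) set" where
  "integer_points = {t. \<forall>i. t $ i \<in> \<int>}"

text \<open>The plane homeomorphisms that commute with integer translations; these are exactly the
  lifts of the homeomorphisms of the 2-torus homotopic to the identity.\<close>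

definition torus_lifts :: "(real^2 \<Rightarrow> real^2) set" where
  "torus_lifts = {F. (\<exists>G. homeomorphism UNIV UNIV F G) \<and>
     (\<forall>x. \<forall>t\<in>integer_points. F (x + t) = F x + t)}"

text \<open>Extended-valued, so that it is meaningful for arbitrary subsets: in \<^typ>\<open>ennreal\<close> the
  supremum of the empty set is 0 and its infimum is infinity. In particular a finite bound on this
  distance is never an artefact of an unbounded or empty set.\<close>

definition hausdorff_dist :: "'a::metric_space set \<Rightarrow> 'a set \<Rightarrow> ennreal" where
  "hausdorff_dist A B =
     max (SUP x\<in>A. INF y\<in>B. ennreal (dist x y)) (SUP y\<in>B. INF x\<in>A. ennreal (dist x y))"

definition rotation_set :: "(real^2 \<Rightarrow> real^2) \<Rightarrow> (real^2) set" where
  "rotation_set F = {v. \<exists>(m :: nat \<Rightarrow> nat) (x :: nat \<Rightarrow> real^2).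
     incseq m \<and> filterlim m at_top sequentially \<and>
     (\<lambda>i. ((F ^^ m i) (x i) - x i) /\<^sub>R real (m i)) \<longlonglongrightarrow> v}"

text \<open>Here and below, \<open>cbox 0 1\<close> is the closed unit square,
  since \<open>1 :: real^2\<close> is the vector with all components 1.\<close>

definition K_set :: "nat \<Rightarrow> (real^2 \<Rightarrow> real^2) \<Rightarrow> (real^2) set" where
  "K_set k F = (\<lambda>x. ((F ^^ k) x - x) /\<^sub>R real k) ` cbox 0 1"

definition initial_boxes :: "real \<Rightarrow> (real^2) set set \<Rightarrow> bool" where
  "initial_boxes \<epsilon> \<B>0 \<longleftrightarrow>
     (\<forall>B\<in>\<B>0. compact B \<and> B \<subseteq> cbox 0 1 \<and> diameter B \<le> \<epsilon>) \<and> \<Union>\<B>0 = cbox 0 1"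

definition all_boxes :: "(real^2) set set \<Rightarrow> (real^2) set set" where
  "all_boxes \<B>0 = {(+) t ` B | B t. B \<in> \<B>0 \<and> t \<in> integer_points}"

definition box_samples ::
    "real \<Rightarrow> (real^2) set set \<Rightarrow> ((real^2) set \<Rightarrow> (real^2) set) \<Rightarrow> bool" where
  "box_samples \<eta> \<B>0 \<Gamma> \<longleftrightarrow>
     (\<forall>B\<in>all_boxes \<B>0.
        finite (\<Gamma> B) \<and> \<Gamma> B \<subseteq> B \<and> (\<forall>y\<in>B. \<exists>x\<in>\<Gamma> B. dist y x \<le> \<eta>) \<and>
        (\<forall>t\<in>integer_points. \<Gamma> ((+) t ` B) = (+) t ` \<Gamma> B))"

text \<open>Since \<^term>\<open>infdist x {} = 0\<close>, the condition \<open>B' \<noteq> {}\<close> is needed to express that the empty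
  set is at infinite distance from every point.\<close>

definition box_image ::
    "(real^2 \<Rightarrow> real^2) \<Rightarrow> real \<Rightarrow> (real^2) set set \<Rightarrow> ((real^2) set \<Rightarrow> (real^2) set) \<Rightarrow>
     (real^2) set \<Rightarrow> (real^2) set set" where
  "box_image F R \<B>0 \<Gamma> B =
     {B' \<in> all_boxes \<B>0. \<exists>x\<in>\<Gamma> B. B' \<noteq> {} \<and> infdist (F x) B' \<le> R}"

primrec box_iterate ::
    "(real^2 \<Rightarrow> real^2) \<Rightarrow> real \<Rightarrow> (real^2) set set \<Rightarrow> ((real^2) set \<Rightarrow> (real^2) set) \<Rightarrow>
     nat \<Rightarrow> (real^2) set set" where
  "box_iterate F R \<B>0 \<Gamma> 0 = \<B>0"
| "box_iterate F R \<B>0 \<Gamma> (Suc k) =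
     {B' \<in> all_boxes \<B>0. \<exists>B\<in>box_iterate F R \<B>0 \<Gamma> k. B' \<in> box_image F R \<B>0 \<Gamma> B}"

text \<open>For \<open>k = 0\<close> this is the unit square by the covering condition in \<open>initial_boxes\<close>.\<close>

definition Q_set ::
    "(real^2 \<Rightarrow> real^2) \<Rightarrow> real \<Rightarrow> (real^2) set set \<Rightarrow> ((real^2) set \<Rightarrow> (real^2) set) \<Rightarrow>
     nat \<Rightarrow> (real^2) set" where
  "Q_set F R \<B>0 \<Gamma> k = \<Union>(box_iterate F R \<B>0 \<Gamma> k)"

definition Q_star ::
    "(real^2 \<Rightarrow> real^2) \<Rightarrow> real \<Rightarrow> (real^2) set set \<Rightarrow> ((real^2) set \<Rightarrow> (real^2) set) \<Rightarrow>
     nat \<Rightarrow> (real^2) set" where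
  "Q_star F R \<B>0 \<Gamma> n = (\<lambda>x. x /\<^sub>R real n) ` Q_set F R \<B>0 \<Gamma> n"

text \<open>For continuous \<open>F\<close> the supremum is attained, hence a maximum.\<close>

definition max_displacement :: "(real^2 \<Rightarrow> real^2) \<Rightarrow> real" where
  "max_displacement F = (SUP x\<in>cbox 0 1. norm (F x - x))"

definition step_error :: "real \<Rightarrow> real \<Rightarrow> real \<Rightarrow> nat \<Rightarrow> real" where
  "step_error c L \<epsilon> k = 1 / real k * (c + 2 * \<epsilon> * ((L ^ k - 1) / (L - 1)))"

text \<open>The argument \<open>k\<close> stands for a minimiser of \<^const>\<open>step_error\<close> over \<open>{1..n}\<close>, which need not
  be unique; the value depends on its choice through \<open>n mod k\<close>.\<close>

definition gamma_bound ::
    "(real^2 \<Rightarrow> real^2) \<Rightarrow> real \<Rightarrow> real \<Rightarrow> real \<Rightarrow> nat \<Rightarrow> nat \<Rightarrow> real" where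
  "gamma_bound F c L \<epsilon> n k =
     2 * real (n mod k) / real n * (max_displacement F + \<epsilon>) +
     (1 - real (n mod k) / real n) * (MIN j\<in>{1..n}. step_error c L \<epsilon> j)"

end

theory Submission
  imports Defs
begin

text \<open>
The two halves of the Hausdorff distance have different reasons.

The rotation set is near the rescaled box iterate because the algorithm loses no true orbit: the box
iterate contains the image of the unit square under the \<open>n\<close>-th iterate of \<open>F\<close>
(\<open>funpow_image_subset_Q_set\<close>), and \<open>K_set n F\<close> comes within \<open>c / n\<close> of every rotation vector by
assumption. The quantity \<open>gamma_bound\<close> is at least \<open>c / n\<close> (\<open>averaged_error_ge\<close>).

Conversely, every point of the box iterate is the end of a pseudo-orbit of length \<open>n\<close> with jumps at
most \<open>2 * \<epsilon>\<close> (\<open>Q_set_pseudo_orbit\<close>). Over \<open>k\<close> steps it drifts away from a true orbit only by a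
geometric sum, so its mean displacement over a block of \<open>k\<close> steps is near the rotation set. The mean
displacement over all blocks is an average of such vectors (\<open>pseudo_orbit_near_rotation_set\<close>), and
for averages one needs the closure of the rotation set to be convex.

Convexity (\<open>convex_closure_rotation_set\<close>) is where injectivity and the dimension enter. The image of
the unit square under an iterate of \<open>F\<close> is path-connected and disjoint from its translates by twice
any nonzero integer vector. If such a set in the plane arches over a hole, that is, over a stretch of
a line which it avoids, then a translate along this line by less than the length of the stretch meets
it (\<open>translate_meets_arch\<close>). So the set cannot extend to opposite sides of a large hole in a direction
near that of a short integer vector (\<open>hole_not_bypassed\<close>). After rescaling by the number of iterations
every hole of fixed size is large in this sense, and every direction is a limit of integer directions.
\<close>

section \<open>Hausdorff distance in terms of point distances\<close>

text \<open>Distances from a point to a nonempty set are finite, so that they can be handled as real numbers.\<close>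

lemma INF_ennreal_dist:
  assumes "B \<noteq> {}"
  shows "(INF y\<in>B. ennreal (dist x y)) = ennreal (infdist x B)"
proof (rule antisym)
  show "(INF y\<in>B. ennreal (dist x y)) \<le> ennreal (infdist x B)"
  proof (rule ennreal_le_epsilon)
    fix e :: real assume "e > 0"
    then have "(INF y\<in>B. dist x y) < infdist x B + e"
      using assms by (simp add: infdist_notempty)
    then obtain y where y: "y \<in> B" "dist x y < infdist x B + e"
      using cInf_lessD[of "dist x ` B"] assms by auto
    have "(INF y\<in>B. ennreal (dist x y)) \<le> ennreal (dist x y)"
      using y(1) by (rule INF_lower)
    also have "\<dots> \<le> ennreal (infdist x B + e)"
      using y by (intro ennreal_leI) simp
    finally show "(INF y\<in>B. ennreal (dist x y)) \<le> ennreal (infdist x B) + ennreal e"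
      using \<open>e > 0\<close> by (simp add: ennreal_plus infdist_nonneg)
  qed
qed (intro INF_greatest ennreal_leI infdist_le)

lemma hausdorff_dist_le_iff:
  assumes "A \<noteq> {}" "B \<noteq> {}" "0 \<le> e"
  shows "hausdorff_dist A B \<le> ennreal e \<longleftrightarrow>
    (\<forall>a\<in>A. infdist a B \<le> e) \<and> (\<forall>b\<in>B. infdist b A \<le> e)"
proof -
  have "(INF x\<in>A. ennreal (dist x y)) = ennreal (infdist y A)" for y
    using INF_ennreal_dist[OF assms(1), of y] by (simp add: dist_commute)
  then show ?thesis
    using assms by (simp add: hausdorff_dist_def SUP_le_iff INF_ennreal_dist ennreal_le_iff)
qed

lemma hausdorff_dist_empty_right:
  assumes "A \<noteq> {}"
  shows "hausdorff_dist A {} = \<infinity>"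
  using assms by (simp add: hausdorff_dist_def max_def top_unique)

section \<open>Lifts of torus homeomorphisms\<close>

lemma torus_lift_shift: "F \<in> torus_lifts \<Longrightarrow> t \<in> integer_points \<Longrightarrow> F (x + t) = F x + t"
  by (simp add: torus_lifts_def)

lemma torus_lift_inj: "F \<in> torus_lifts \<Longrightarrow> inj F"
  by (auto simp: torus_lifts_def homeomorphism_def intro: inj_on_inverseI)

lemma torus_lift_continuous: "F \<in> torus_lifts \<Longrightarrow> continuous_on S F"
  by (auto simp: torus_lifts_def homeomorphism_def intro: continuous_on_subset)

lemma torus_lift_funpow:
  assumes F: "F \<in> torus_lifts"
  shows "F ^^ n \<in> torus_lifts"
proof (induction n)
  case 0
  show ?case
    using homeomorphism_ident[of UNIV] by (auto simp: torus_lifts_def id_def)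
next
  case (Suc n)
  obtain G H where "homeomorphism UNIV UNIV (F ^^ n) G" "homeomorphism UNIV UNIV F H"
    using F Suc by (auto simp: torus_lifts_def)
  then have "\<exists>G. homeomorphism UNIV UNIV (F ^^ Suc n) G"
    unfolding funpow.simps by (blast intro: homeomorphism_compose)
  moreover have "\<forall>x. \<forall>t\<in>integer_points. (F ^^ Suc n) (x + t) = (F ^^ Suc n) x + t"
    using F Suc by (simp add: torus_lifts_def)
  ultimately show ?case
    unfolding torus_lifts_def by blast
qed

lemma integer_translate_in_unit_square:
  fixes x :: "real^2"
  obtains t where "t \<in> integer_points" "x - t \<in> cbox 0 1"
proof -
  define t :: "real^2" where "t = (\<chi> i. real_of_int \<lfloor>x $ i\<rfloor>)"
  have "t \<in> integer_points" by (simp add: t_def integer_points_def)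
  have "0 \<le> x $ i - real_of_int \<lfloor>x $ i\<rfloor>" "x $ i - real_of_int \<lfloor>x $ i\<rfloor> \<le> 1" for i
    by linarith+
  then have "x - t \<in> cbox 0 1" by (simp add: t_def mem_box_cart)
  with \<open>t \<in> integer_points\<close> show ?thesis by (rule that)
qed

lemma K_set_nonempty: "K_set m F \<noteq> {}"
proof -
  have "(0::real^2) \<in> cbox 0 1" by (simp add: mem_box_cart)
  then show ?thesis by (auto simp: K_set_def)
qed

lemma norm_unit_square_le:
  fixes x :: "real^2"
  assumes "x \<in> cbox 0 1"
  shows "norm x \<le> sqrt 2"
proof -
  have "(x $ 1)\<^sup>2 \<le> 1" "(x $ 2)\<^sup>2 \<le> 1"
    using assms by (auto simp: mem_box_cart forall_2 intro: power_le_one)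
  then show ?thesis
    by (simp add: norm_vec_def L2_set_def sum_2)
qed

text \<open>The displacement is periodic, so its values on the plane are its values on the unit square.\<close>

lemma torus_lift_displacement:
  assumes "F \<in> torus_lifts"
  obtains y where "y \<in> cbox 0 1" "F x - x = F y - y"
proof -
  obtain t where t: "t \<in> integer_points" "x - t \<in> cbox 0 1"
    by (rule integer_translate_in_unit_square)
  have "F x = F (x - t) + t"
    using torus_lift_shift[OF assms t(1), of "x - t"] by simp
  then show ?thesis using that[OF t(2)] by simp
qed

lemma norm_displacement_le:
  assumes F: "F \<in> torus_lifts"
  shows "norm (F x - x) \<le> max_displacement F"
proof -
  obtain y where y: "y \<in> cbox 0 1" "F x - x = F y - y"
    using torus_lift_displacement[OF F] .
  have "compact ((\<lambda>y. norm (F y - y)) ` cbox 0 1)"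
    by (intro compact_continuous_image continuous_intros torus_lift_continuous[OF F]) auto
  then have "bdd_above ((\<lambda>y. norm (F y - y)) ` cbox 0 1)"
    by (intro bounded_imp_bdd_above compact_imp_bounded)
  then show ?thesis
    unfolding y(2) max_displacement_def using y(1) by (intro cSUP_upper)
qed

text \<open>True orbits are the case \<open>e = 0\<close>. The version with jumps is needed for the incomplete last block of a
pseudo-orbit.\<close>

lemma pseudo_orbit_displacement_le:
  assumes F: "F \<in> torus_lifts" and x: "\<And>i. i < m \<Longrightarrow> dist (F (x i)) (x (Suc i)) \<le> e"
  shows "norm (x m - x 0) \<le> real m * (max_displacement F + e)"
  using x
proof (induction m)
  case (Suc m)
  have "x (Suc m) - x 0 = (x m - x 0) + (F (x m) - x m) + (x (Suc m) - F (x m))" by simp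
  also have "norm \<dots> \<le> norm (x m - x 0) + norm (F (x m) - x m) + norm (x (Suc m) - F (x m))"
    by (intro order.trans[OF norm_triangle_ineq] add_right_mono norm_triangle_ineq)
  also have "\<dots> \<le> real m * (max_displacement F + e) + max_displacement F + e"
    using Suc norm_displacement_le[OF F, of "x m"] by (intro add_mono) (auto simp: dist_norm norm_minus_commute)
  finally show ?case by (simp add: algebra_simps)
qed simp

lemma norm_rotation_vector_le:
  assumes F: "F \<in> torus_lifts" and v: "v \<in> closure (rotation_set F)"
  shows "norm v \<le> max_displacement F"
proof -
  have "0 \<le> max_displacement F"
    using norm_displacement_le[OF F, of 0] norm_ge_zero order.trans by blast
  have avg: "norm (((F ^^ m) x - x) /\<^sub>R real m) \<le> max_displacement F" for m x
    using pseudo_orbit_displacement_le[OF F, of m "\<lambda>i. (F ^^ i) x" 0] \<open>0 \<le> max_displacement F\<close>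
    by (cases "m = 0") (auto simp: divide_simps mult.commute)
  have "rotation_set F \<subseteq> cball 0 (max_displacement F)"
    unfolding rotation_set_def using avg by (auto intro!: Lim_norm_ubound[of sequentially])
  then have "closure (rotation_set F) \<subseteq> cball 0 (max_displacement F)"
    by (rule closure_minimal) simp
  then show ?thesis using v by auto
qed

section \<open>Planar sets disjoint from a translate\<close>

text \<open>An arch standing on a line, together with the part of the line below it, bounds a region. A
translate along the line by less than the width of the arch starts inside and ends outside, and
never goes below the line, so it has to cross the arch itself. The crossing comes from the
interlaced form of the Fashoda meet theorem, in a box whose bottom edge lies on the line.\<close>

lemma translate_meets_arch:
  fixes g :: "real \<Rightarrow> real^2"
  assumes g: "path g" and above: "\<And>x. x \<in> path_image g \<Longrightarrow> t \<le> x $ 2"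
    and ends: "pathstart g $ 2 = t" "pathfinish g $ 2 = t"
    and wide: "pathstart g $ 1 + \<kappa> < pathfinish g $ 1" and "\<kappa> > 0"
  shows "\<exists>x\<in>path_image g. x + \<kappa> *\<^sub>R axis 1 1 \<in> path_image g"
proof -
  define s :: "real^2" where "s = \<kappa> *\<^sub>R axis 1 1"
  have s: "s $ 1 = \<kappa>" "s $ 2 = 0"
    by (simp_all add: s_def axis_def)
  define h where "h = (+) s \<circ> g"
  have h: "path h" and h_image: "path_image h = (+) s ` path_image g"
    using g unfolding h_def by (simp_all add: path_translation_eq path_image_translation)
  have "bounded (path_image g \<union> path_image h)"
    using g h by (simp add: bounded_path_image)
  then obtain b where b: "\<And>x. x \<in> path_image g \<union> path_image h \<Longrightarrow> norm x \<le> b"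
    unfolding bounded_iff by blast
  have low: "t \<le> x $ 2" if "x \<in> path_image g \<union> path_image h" for x
    using that above s unfolding h_image by auto
  have in_box: "path_image g \<union> path_image h \<subseteq> cbox (vector [-b, t]) (vector [b, b])"
  proof
    fix x assume x: "x \<in> path_image g \<union> path_image h"
    have "\<bar>x $ i\<bar> \<le> b" for i
      using b[OF x] component_le_norm_cart[of x i] by linarith
    from this[of 1] this[of 2] low[OF x] show "x \<in> cbox (vector [-b, t]) (vector [b, b])"
      by (simp add: mem_box_cart forall_2 abs_le_iff)
  qed
  obtain y where "y \<in> path_image g" "y \<in> path_image h"
  proof (rule fashoda_interlace[OF g h])
    show "path_image g \<subseteq> cbox (vector [-b, t]) (vector [b, b])"
      "path_image h \<subseteq> cbox (vector [-b, t]) (vector [b, b])"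
      using in_box by auto
  qed (use ends wide \<open>\<kappa> > 0\<close> s in \<open>auto simp: h_def pathstart_def pathfinish_def\<close>)
  then show ?thesis
    by (auto simp: h_image s_def add.commute)
qed

lemma translate_meets_arch_below:
  fixes g :: "real \<Rightarrow> real^2"
  assumes g: "path g" and below: "\<And>x. x \<in> path_image g \<Longrightarrow> x $ 2 \<le> t"
    and ends: "pathstart g $ 2 = t" "pathfinish g $ 2 = t"
    and wide: "pathstart g $ 1 + \<kappa> < pathfinish g $ 1" and "\<kappa> > 0"
  shows "\<exists>x\<in>path_image g. x + \<kappa> *\<^sub>R axis 1 1 \<in> path_image g"
proof -
  define m :: "real^2 \<Rightarrow> real^2" where "m x = (\<chi> i. if i = 2 then - x $ 2 else x $ i)" for x
  have m: "m x $ 1 = x $ 1" "m x $ 2 = - x $ 2" for x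
    by (simp_all add: m_def)
  have m_shift: "m (x + \<kappa> *\<^sub>R axis 1 1) = m x + \<kappa> *\<^sub>R axis 1 1" and m_inv: "m (m x) = x" for x
    by (simp_all add: vec_eq_iff forall_2 m axis_def)
  have "continuous_on UNIV (\<lambda>x::real^2. if i = 2 then - x $ 2 else x $ i)" for i
    by (cases "i = 2") (auto intro!: continuous_intros)
  then have "continuous_on UNIV m"
    unfolding m_def by (intro continuous_on_vec_lambda) auto
  then have path: "path (m \<circ> g)"
    using g path_continuous_image continuous_on_subset by blast
  have "\<exists>x\<in>path_image (m \<circ> g). x + \<kappa> *\<^sub>R axis 1 1 \<in> path_image (m \<circ> g)"
    by (rule translate_meets_arch[OF path, of "-t"])
      (use below ends wide \<open>\<kappa> > 0\<close> in
        \<open>auto simp: path_image_compose m pathstart_compose pathfinish_compose\<close>)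
  then obtain x y where "x \<in> path_image g" "y \<in> path_image g" "m x + \<kappa> *\<^sub>R axis 1 1 = m y"
    by (auto simp: path_image_compose)
  then show ?thesis
    by (metis m_shift m_inv)
qed

text \<open>Between the last visit to the part of the line left of the gap and the next visit to the part right
of it, the path stays off the line. That portion is an arch, standing above or hanging below.\<close>

lemma translate_meets_path_over_gap:
  fixes g :: "real \<Rightarrow> real^2"
  assumes g: "path g"
    and start: "pathstart g $ 2 = t" "pathstart g $ 1 \<le> a"
    and finish: "pathfinish g $ 2 = t" "pathfinish g $ 1 \<ge> b"
    and gap: "\<And>x. x \<in> path_image g \<Longrightarrow> x $ 2 = t \<Longrightarrow> x $ 1 \<le> a \<or> x $ 1 \<ge> b"
    and "a + \<kappa> < b" "\<kappa> > 0"
  shows "\<exists>x\<in>path_image g. x + \<kappa> *\<^sub>R axis 1 1 \<in> path_image g"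
proof -
  have cont: "continuous_on {0..1} (\<lambda>\<tau>. g \<tau> $ i)" for i
    using g unfolding path_def by (intro continuous_intros)
  have cl: "compact {\<tau>\<in>{0..\<sigma>}. g \<tau> $ 2 = t \<and> P (g \<tau> $ 1)}"
    if "\<sigma> \<le> 1" "closed {x. P x}" for P \<sigma>
  proof -
    have c: "continuous_on {0..\<sigma>} (\<lambda>\<tau>. g \<tau> $ i)" for i
      using cont by (rule continuous_on_subset) (use that in auto)
    have "closed ({0..\<sigma>} \<inter> (\<lambda>\<tau>. g \<tau> $ 2) -` {t})"
      by (rule continuous_closed_preimage[OF c]) auto
    moreover have "closed ({0..\<sigma>} \<inter> (\<lambda>\<tau>. g \<tau> $ 1) -` {x. P x})"
      by (rule continuous_closed_preimage[OF c]) (use that in auto)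
    ultimately have "closed (({0..\<sigma>} \<inter> (\<lambda>\<tau>. g \<tau> $ 2) -` {t}) \<inter> ({0..\<sigma>} \<inter> (\<lambda>\<tau>. g \<tau> $ 1) -` {x. P x}))"
      by (rule closed_Int)
    moreover have "({0..\<sigma>} \<inter> (\<lambda>\<tau>. g \<tau> $ 2) -` {t}) \<inter> ({0..\<sigma>} \<inter> (\<lambda>\<tau>. g \<tau> $ 1) -` {x. P x})
      = {\<tau>\<in>{0..\<sigma>}. g \<tau> $ 2 = t \<and> P (g \<tau> $ 1)}" by auto
    moreover have "bounded {\<tau>\<in>{0..\<sigma>}. g \<tau> $ 2 = t \<and> P (g \<tau> $ 1)}"
      by (rule bounded_subset[of "{0..\<sigma>}"]) auto
    ultimately show ?thesis
      by (simp add: compact_eq_bounded_closed)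
  qed
  let ?right = "{\<tau>\<in>{0..1}. g \<tau> $ 2 = t \<and> b \<le> g \<tau> $ 1}"
  have "closed {x. b \<le> x}" using closed_atLeast[of b] by (simp add: atLeast_def)
  then have "compact ?right" by (intro cl) auto
  moreover have "1 \<in> ?right"
    using finish by (simp add: pathfinish_def)
  ultimately obtain \<tau>1 where \<tau>1: "\<tau>1 \<in> ?right" and \<tau>1_first: "\<And>\<tau>. \<tau> \<in> ?right \<Longrightarrow> \<tau>1 \<le> \<tau>"
    using compact_attains_inf[of ?right] by blast
  let ?left = "{\<tau>\<in>{0..\<tau>1}. g \<tau> $ 2 = t \<and> g \<tau> $ 1 \<le> a}"
  have "closed {x. x \<le> a}" using closed_atMost[of a] by (simp add: atMost_def)
  then have "compact ?left" using \<tau>1 by (intro cl) auto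
  moreover have "0 \<in> ?left"
    using start \<tau>1 by (simp add: pathstart_def)
  ultimately obtain \<tau>0 where \<tau>0: "\<tau>0 \<in> ?left" and \<tau>0_last: "\<And>\<tau>. \<tau> \<in> ?left \<Longrightarrow> \<tau> \<le> \<tau>0"
    using compact_attains_sup[of ?left] by blast
  have order: "0 \<le> \<tau>0" "\<tau>0 \<le> \<tau>1" "\<tau>1 \<le> 1"
    using \<tau>0 \<tau>1 by auto
  have off: "g \<tau> $ 2 \<noteq> t" if "\<tau>0 < \<tau>" "\<tau> < \<tau>1" for \<tau>
  proof
    assume t: "g \<tau> $ 2 = t"
    have "\<tau> \<in> {0..1}" using that order by auto
    then have "g \<tau> $ 1 \<le> a \<or> b \<le> g \<tau> $ 1"
      using gap[of "g \<tau>"] t by (auto simp: path_image_def)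
    then show False
      using \<tau>0_last[of \<tau>] \<tau>1_first[of \<tau>] that order t by auto
  qed
  let ?h = "subpath \<tau>0 \<tau>1 g"
  have h: "path ?h" using g order by simp
  have h_image: "path_image ?h = g ` {\<tau>0..\<tau>1}" "path_image ?h \<subseteq> path_image g"
    using order by (simp_all add: path_image_subpath) (auto simp: path_image_def)
  have h_ends: "pathstart ?h $ 2 = t" "pathfinish ?h $ 2 = t"
    "pathstart ?h $ 1 + \<kappa> < pathfinish ?h $ 1"
    using \<tau>0 \<tau>1 \<open>a + \<kappa> < b\<close> by auto
  have one_side: "(\<forall>\<tau>\<in>{\<tau>0<..<\<tau>1}. g \<tau> $ 2 > t) \<or> (\<forall>\<tau>\<in>{\<tau>0<..<\<tau>1}. g \<tau> $ 2 < t)"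
  proof (rule ccontr)
    assume "\<not> ?thesis"
    then obtain \<alpha> \<beta> where *: "\<alpha> \<in> {\<tau>0<..<\<tau>1}" "\<beta> \<in> {\<tau>0<..<\<tau>1}" "g \<alpha> $ 2 \<le> t" "g \<beta> $ 2 \<ge> t"
      by (auto simp: not_less)
    have "connected ((\<lambda>\<tau>. g \<tau> $ 2) ` {\<tau>0<..<\<tau>1})"
      using order
      by (intro connected_continuous_image connected_Ioo continuous_on_subset[OF cont]) auto
    then have "t \<in> (\<lambda>\<tau>. g \<tau> $ 2) ` {\<tau>0<..<\<tau>1}"
      using * connectedD_interval by blast
    then obtain \<tau> where "\<tau>0 < \<tau>" "\<tau> < \<tau>1" "g \<tau> $ 2 = t" by auto
    then show False using off[of \<tau>] by simp
  qed
  have ends': "g \<tau>0 $ 2 = t" "g \<tau>1 $ 2 = t" using \<tau>0 \<tau>1 by auto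
  from one_side have "\<exists>x\<in>path_image ?h. x + \<kappa> *\<^sub>R axis 1 1 \<in> path_image ?h"
  proof
    assume *: "\<forall>\<tau>\<in>{\<tau>0<..<\<tau>1}. g \<tau> $ 2 > t"
    have "t \<le> g \<tau> $ 2" if "\<tau> \<in> {\<tau>0..\<tau>1}" for \<tau>
      using * ends' that by (cases "\<tau> = \<tau>0 \<or> \<tau> = \<tau>1") (auto intro: less_imp_le)
    then show ?thesis
      by (intro translate_meets_arch[OF h _ h_ends \<open>\<kappa> > 0\<close>]) (auto simp: h_image(1))
  next
    assume *: "\<forall>\<tau>\<in>{\<tau>0<..<\<tau>1}. g \<tau> $ 2 < t"
    have "g \<tau> $ 2 \<le> t" if "\<tau> \<in> {\<tau>0..\<tau>1}" for \<tau>
      using * ends' that by (cases "\<tau> = \<tau>0 \<or> \<tau> = \<tau>1") (auto intro: less_imp_le)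
    then show ?thesis
      by (intro translate_meets_arch_below[OF h _ h_ends \<open>\<kappa> > 0\<close>]) (auto simp: h_image(1))
  qed
  then show ?thesis using h_image(2) by blast
qed

lemma connected_vanishes:
  fixes \<phi> :: "'a::topological_space \<Rightarrow> real"
  assumes "connected S" "continuous_on S \<phi>" "u \<in> S" "v \<in> S" "0 < \<phi> u" "\<phi> v < 0"
  obtains x where "x \<in> S" "\<phi> x = 0"
proof -
  have "connected (\<phi> ` S)" using assms by (intro connected_continuous_image)
  then have "0 \<in> \<phi> ` S"
    using assms connectedD_interval[of "\<phi> ` S" "\<phi> v" "\<phi> u" 0] by (simp add: less_imp_le)
  then show ?thesis using that by auto
qed

text \<open>Let the hole be the square of radius \<open>s\<close> about \<open>z\<close>. By \<open>translate_meets_path_over_gap\<close>, the set \<open>S\<close>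
cannot meet a horizontal line through the hole on both sides of it. So \<open>S\<close> misses one of the two
rays outside the hole on the line along the top edge, and likewise on the line along the bottom
edge. Two missed rays, joined by a vertical segment through the hole, form a curve which \<open>S\<close> does
not meet. Whichever of the four combinations occurs, this curve separates \<open>u\<close> from \<open>v\<close>, against the
connectedness of \<open>S\<close>.

Two lines are needed because \<open>u\<close> and \<open>v\<close> are only near the horizontal line through \<open>z\<close>: a
connected set may reach \<open>v\<close> from \<open>u\<close> while crossing that single line only on the right.\<close>

lemma hole_not_bypassed_horizontal:
  fixes S :: "(real^2) set"
  assumes S: "path_connected S"
    and disj: "\<And>x. x \<in> S \<Longrightarrow> x + \<kappa> *\<^sub>R axis 1 1 \<notin> S" and "\<kappa> > 0" "\<kappa> < 2 * s"
    and hole: "\<And>x. x \<in> S \<Longrightarrow> \<bar>x $ 2 - z $ 2\<bar> \<le> s \<Longrightarrow> s < \<bar>x $ 1 - z $ 1\<bar>"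
    and u: "u \<in> S" "u $ 1 < z $ 1" "\<bar>u $ 2 - z $ 2\<bar> < s"
    and v: "v \<in> S" "z $ 1 < v $ 1" "\<bar>v $ 2 - z $ 2\<bar> < s"
  shows False
proof -
  have one_sided: False
    if pq: "p \<in> S" "q \<in> S" "p $ 1 \<le> z $ 1" "z $ 1 \<le> q $ 1" "p $ 2 = t" "q $ 2 = t"
      and t: "\<bar>t - z $ 2\<bar> \<le> s" for p q t
  proof -
    obtain g where g: "path g" "path_image g \<subseteq> S" "pathstart g = p" "pathfinish g = q"
      using S pq(1,2) unfolding path_connected_def by blast
    have "\<exists>x\<in>path_image g. x + \<kappa> *\<^sub>R axis 1 1 \<in> path_image g"
    proof (rule translate_meets_path_over_gap[OF g(1), where t = t and a = "z $ 1 - s" and b = "z $ 1 + s"])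
      show "x $ 1 \<le> z $ 1 - s \<or> z $ 1 + s \<le> x $ 1" if "x \<in> path_image g" "x $ 2 = t" for x
        using hole[of x] that t g(2) by (auto simp: abs_if split: if_splits)
      show "pathstart g $ 1 \<le> z $ 1 - s"
        using hole[of p] pq t g by (auto simp: abs_if split: if_splits)
      show "pathfinish g $ 1 \<ge> z $ 1 + s"
        using hole[of q] pq t g by (auto simp: abs_if split: if_splits)
    qed (use g pq \<open>\<kappa> > 0\<close> \<open>\<kappa> < 2 * s\<close> in auto)
    then show False using disj g(2) by blast
  qed
  have "s > 0" using \<open>\<kappa> > 0\<close> \<open>\<kappa> < 2 * s\<close> by linarith
  have conn: "connected S" using S by (rule path_connected_imp_connected)
  define X where "X x = x $ 1 - z $ 1" for x :: "real^2"
  define Y where "Y x = x $ 2 - z $ 2" for x :: "real^2"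
  have contXY: "continuous_on S X" "continuous_on S Y"
    unfolding X_def Y_def by (intro continuous_intros)+
  have uv: "X u < 0" "\<bar>Y u\<bar> < s" "X v > 0" "\<bar>Y v\<bar> < s"
    using u v by (auto simp: X_def Y_def)
  have hole': "s < \<bar>X x\<bar>" if "x \<in> S" "\<bar>Y x\<bar> \<le> s" for x
    using hole that by (simp add: X_def Y_def)
  have middle: "X x \<noteq> 0" if "x \<in> S" "- s \<le> Y x" "Y x \<le> s" for x
    using hole'[of x] that \<open>s > 0\<close> by (auto simp: abs_le_iff)
  have line: "X p > 0 \<and> X q > 0 \<or> X p < 0 \<and> X q < 0"
    if "p \<in> S" "q \<in> S" "Y p = t" "Y q = t" "\<bar>t\<bar> \<le> s" for p q t
  proof -
    have "X p \<noteq> 0" "X q \<noteq> 0"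
      using hole'[of p] hole'[of q] that \<open>s > 0\<close> by auto
    moreover have "\<not> (X p \<le> 0 \<and> X q \<ge> 0)" "\<not> (X q \<le> 0 \<and> X p \<ge> 0)"
      using one_sided[of p q "z $ 2 + t"] one_sided[of q p "z $ 2 + t"] that
      by (auto simp: X_def Y_def)
    ultimately show ?thesis by linarith
  qed
  have top: "(\<forall>x\<in>S. Y x = s \<longrightarrow> X x > 0) \<or> (\<forall>x\<in>S. Y x = s \<longrightarrow> X x < 0)"
    using line[where t = s] \<open>s > 0\<close> by (cases "\<exists>x\<in>S. Y x = s \<and> X x < 0") fastforce+
  have bottom: "(\<forall>x\<in>S. Y x = - s \<longrightarrow> X x > 0) \<or> (\<forall>x\<in>S. Y x = - s \<longrightarrow> X x < 0)"
    using line[where t = "-s"] \<open>s > 0\<close> by (cases "\<exists>x\<in>S. Y x = - s \<and> X x < 0") fastforce+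
  note cont = contXY continuous_on_min continuous_on_max continuous_on_minus continuous_on_add
    continuous_on_diff continuous_on_const
  \<comment> \<open>In each case the function below vanishes only on the separating curve and is
    positive exactly on one side of it. The side is a half-strip if the two missed rays point the
    same way, and a half-plane with a half-strip attached to it otherwise.\<close>
  consider
    "\<forall>x\<in>S. Y x = s \<longrightarrow> X x > 0" "\<forall>x\<in>S. Y x = - s \<longrightarrow> X x > 0"
    | "\<forall>x\<in>S. Y x = s \<longrightarrow> X x < 0" "\<forall>x\<in>S. Y x = - s \<longrightarrow> X x < 0"
    | "\<forall>x\<in>S. Y x = s \<longrightarrow> X x < 0" "\<forall>x\<in>S. Y x = - s \<longrightarrow> X x > 0"
    | "\<forall>x\<in>S. Y x = s \<longrightarrow> X x > 0" "\<forall>x\<in>S. Y x = - s \<longrightarrow> X x < 0"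
    using top bottom by blast
  then show False
  proof cases
    case 1
    obtain x where "x \<in> S" "min (- X x) (min (Y x + s) (s - Y x)) = 0"
      by (rule connected_vanishes[OF conn _ u(1) v(1), of "\<lambda>x. min (- X x) (min (Y x + s) (s - Y x))"]) (use uv in \<open>auto intro!: cont\<close>)
    then show False using 1 middle[of x] by (auto simp: min_def split: if_splits)
  next
    case 2
    obtain x where "x \<in> S" "min (X x) (min (Y x + s) (s - Y x)) = 0"
      by (rule connected_vanishes[OF conn _ v(1) u(1), of "\<lambda>x. min (X x) (min (Y x + s) (s - Y x))"]) (use uv in \<open>auto intro!: cont\<close>)
    then show False using 2 middle[of x] by (auto simp: min_def split: if_splits)
  next
    case 3
    obtain x where "x \<in> S" "max (min (- X x) (Y x + s)) (Y x - s) = 0"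
      by (rule connected_vanishes[OF conn _ u(1) v(1), of "\<lambda>x. max (min (- X x) (Y x + s)) (Y x - s)"]) (use uv in \<open>auto intro!: cont\<close>)
    then show False using 3 middle[of x] \<open>s > 0\<close>
      by (auto simp: min_def max_def split: if_splits)
  next
    case 4
    obtain x where "x \<in> S" "max (min (- X x) (s - Y x)) (- s - Y x) = 0"
      by (rule connected_vanishes[OF conn _ u(1) v(1), of "\<lambda>x. max (min (- X x) (s - Y x)) (- s - Y x)"]) (use uv in \<open>auto intro!: cont\<close>)
    then show False using 4 middle[of x] \<open>s > 0\<close>
      by (auto simp: min_def max_def split: if_splits)
  qed
qed

text \<open>The direction of the translation becomes horizontal under the isometry that takes the coordinates
of a point along \<open>d\<close> and along the normal of \<open>d\<close>. The conditions on \<open>u\<close> and \<open>v\<close> do not change when \<open>d\<close>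
is multiplied by a positive number, which allows a fixed integer direction \<open>d\<close> with shorter and
shorter translations \<open>\<tau> *\<^sub>R d\<close>.\<close>

lemma hole_not_bypassed:
  fixes S :: "(real^2) set" and d :: "real^2"
  assumes S: "path_connected S"
    and disj: "\<And>x. x \<in> S \<Longrightarrow> x + \<tau> *\<^sub>R d \<notin> S" and d: "d \<noteq> 0" "\<tau> > 0" "\<tau> * norm d < r / 2"
    and hole: "\<And>x. x \<in> S \<Longrightarrow> r \<le> dist x z"
    and u: "u \<in> S" "d \<bullet> (u - z) < 0"
      "\<bar>d $ 1 * (u - z) $ 2 - d $ 2 * (u - z) $ 1\<bar> < r / 3 * norm d"
    and v: "v \<in> S" "0 < d \<bullet> (v - z)"
      "\<bar>d $ 1 * (v - z) $ 2 - d $ 2 * (v - z) $ 1\<bar> < r / 3 * norm d"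
  shows False
proof -
  define T :: "real^2 \<Rightarrow> real^2" where
    "T x = ((d \<bullet> x) / norm d) *\<^sub>R axis 1 1 + ((d $ 1 * x $ 2 - d $ 2 * x $ 1) / norm d) *\<^sub>R axis 2 1"
    for x
  have T: "T x $ 1 = (d \<bullet> x) / norm d" "T x $ 2 = (d $ 1 * x $ 2 - d $ 2 * x $ 1) / norm d" for x
    by (simp_all add: T_def axis_def)
  have nd: "norm d > 0" using d by simp
  have T_add: "T (x + y) = T x + T y" and T_diff: "T (x - y) = T x - T y" for x y
    using nd by (simp_all add: vec_eq_iff forall_2 T inner_add_right inner_diff_right field_simps)
  have Td: "T (\<tau> *\<^sub>R d) = (\<tau> * norm d) *\<^sub>R axis 1 1"
    using nd by (simp add: vec_eq_iff forall_2 T axis_def dot_square_norm power2_eq_square)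
  have T_norm: "(norm x)\<^sup>2 = (T x $ 1)\<^sup>2 + (T x $ 2)\<^sup>2" for x
  proof -
    have "(d \<bullet> x)\<^sup>2 + (d $ 1 * x $ 2 - d $ 2 * x $ 1)\<^sup>2 = (norm d)\<^sup>2 * (norm x)\<^sup>2"
      unfolding power2_norm_eq_inner
      by (simp add: inner_vec_def sum_2) (simp add: power2_eq_square algebra_simps)
    then show ?thesis
      using nd by (simp add: T power_divide field_simps)
  qed
  have norm_le: "norm x \<le> \<bar>T x $ 1\<bar> + \<bar>T x $ 2\<bar>" for x
    by (rule power2_le_imp_le) (simp_all add: T_norm power2_sum)
  have "inj T"
  proof (rule injI)
    fix x y assume "T x = T y"
    then have "T (x - y) = 0" by (simp add: T_diff)
    then show "x = y" using norm_le[of "x - y"] by simp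
  qed
  have "continuous_on S T"
    unfolding T_def by (intro continuous_intros) (use nd in auto)
  then have "path_connected (T ` S)" using S by (rule path_connected_continuous_image)
  then show False
  proof (rule hole_not_bypassed_horizontal[where \<kappa> = "\<tau> * norm d" and s = "r / 3" and z = "T z"
        and u = "T u" and v = "T v"])
    show "y + (\<tau> * norm d) *\<^sub>R axis 1 1 \<notin> T ` S" if "y \<in> T ` S" for y
    proof -
      from that obtain x where x: "x \<in> S" "y = T x" by auto
      then have "T (x + \<tau> *\<^sub>R d) \<notin> T ` S"
        using disj \<open>inj T\<close> by (simp add: inj_image_mem_iff)
      then show ?thesis by (simp add: T_add Td x)
    qed
    have pos: "\<tau> * norm d > 0" using nd d by simp
    then show "\<tau> * norm d < 2 * (r / 3)" using d by linarith
    show "r / 3 < \<bar>y $ 1 - T z $ 1\<bar>" if "y \<in> T ` S" "\<bar>y $ 2 - T z $ 2\<bar> \<le> r / 3" for y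
    proof -
      from that obtain x where x: "x \<in> S" "y = T x" by auto
      have "r \<le> norm (x - z)" using hole[OF x(1)] by (simp add: dist_norm)
      also have "\<dots> \<le> \<bar>y $ 1 - T z $ 1\<bar> + \<bar>y $ 2 - T z $ 2\<bar>"
        using norm_le[of "x - z"] by (simp add: T_diff x)
      finally show ?thesis using that(2) d pos by linarith
    qed
    have "(T u - T z) $ 1 < 0" "0 < (T v - T z) $ 1"
      "\<bar>(T u - T z) $ 2\<bar> < r / 3" "\<bar>(T v - T z) $ 2\<bar> < r / 3"
      using u v nd unfolding T_diff[symmetric] T
      by (auto simp: divide_neg_pos abs_divide pos_divide_less_eq simp del: vector_minus_component)
    then show "T u $ 1 < T z $ 1" "T z $ 1 < T v $ 1" "\<bar>T u $ 2 - T z $ 2\<bar> < r / 3"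
      "\<bar>T v $ 2 - T z $ 2\<bar> < r / 3" by simp_all
  qed (use nd d u v in auto)
qed

section \<open>Convexity of the closure of the rotation set\<close>

text \<open>Every direction in the plane is a limit of directions of integer vectors.\<close>

lemma floor_multiples_tendsto:
  fixes w :: "real^2"
  shows "(\<lambda>m. (\<chi> i. real_of_int \<lfloor>real m * w $ i\<rfloor>) /\<^sub>R real m) \<longlonglongrightarrow> w"
proof (rule vec_tendstoI)
  fix i
  have lim: "(\<lambda>m. inverse (real m)) \<longlonglongrightarrow> 0"
    by (rule LIMSEQ_inverse_real_of_nat[THEN LIMSEQ_imp_Suc])
  have bound: "norm (real_of_int \<lfloor>real m * w $ i\<rfloor> / real m - w $ i) \<le> inverse (real m)" if "m > 0" for m
  proof -
    have "\<bar>real_of_int \<lfloor>real m * w $ i\<rfloor> - real m * w $ i\<bar> \<le> 1" by linarith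
    then have "\<bar>real_of_int \<lfloor>real m * w $ i\<rfloor> - real m * w $ i\<bar> / real m \<le> 1 / real m"
      by (rule divide_right_mono) simp
    moreover have "real_of_int \<lfloor>real m * w $ i\<rfloor> / real m - w $ i
        = (real_of_int \<lfloor>real m * w $ i\<rfloor> - real m * w $ i) / real m"
      using that by (simp add: field_simps)
    ultimately show ?thesis by (simp add: inverse_eq_divide)
  qed
  have "(\<lambda>m. real_of_int \<lfloor>real m * w $ i\<rfloor> / real m - w $ i) \<longlonglongrightarrow> 0"
    by (rule Lim_null_comparison[OF _ lim])
      (use bound in \<open>auto simp: eventually_sequentially intro!: exI[of _ 1]\<close>)
  then have "(\<lambda>m. real_of_int \<lfloor>real m * w $ i\<rfloor> / real m) \<longlonglongrightarrow> w $ i"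
    by (simp add: LIM_zero_iff)
  then show "(\<lambda>m. ((\<chi> i. real_of_int \<lfloor>real m * w $ i\<rfloor>) /\<^sub>R real m) $ i) \<longlonglongrightarrow> w $ i"
    by (simp add: divide_inverse mult.commute)
qed

text \<open>The factor 2 moves the closed unit square off itself; a unit translate would still share an edge
with it. Injectivity of \<open>F\<close> carries the disjointness over to the images.\<close>

lemma lift_image_disjoint_translate:
  assumes F: "F \<in> torus_lifts" and t: "t \<in> integer_points" "t \<noteq> 0"
    and x: "x \<in> F ` cbox 0 1"
  shows "x + 2 *\<^sub>R t \<notin> F ` cbox 0 1"
proof
  have t2: "2 *\<^sub>R t \<in> integer_points"
    using t(1) by (auto simp: integer_points_def)
  assume "x + 2 *\<^sub>R t \<in> F ` cbox 0 1"
  with x obtain a b where ab: "a \<in> cbox 0 1" "b \<in> cbox 0 1" "F a + 2 *\<^sub>R t = F b" by auto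
  then have "F (a + 2 *\<^sub>R t) = F b"
    using torus_lift_shift[OF F t2] by simp
  then have eq: "b = a + 2 *\<^sub>R t"
    using torus_lift_inj[OF F] by (simp add: inj_eq)
  obtain i where i: "t $ i \<noteq> 0"
    using t(2) by (auto simp: vec_eq_iff)
  obtain l :: int where l: "t $ i = real_of_int l"
    using t(1) by (auto simp: integer_points_def elim: Ints_cases)
  have "\<bar>t $ i\<bar> \<ge> 1" using i l by simp
  moreover have "\<bar>2 * t $ i\<bar> \<le> 1"
    using ab(1,2) eq by (auto simp: mem_box_cart abs_le_iff dest!: spec[of _ i])
  ultimately show False by simp
qed

text \<open>This is a form of the Misiurewicz-Ziemian convexity theorem, made quantitative by the assumed
rate \<open>c / m\<close>. Suppose that \<open>u\<close> and \<open>v\<close> lie in the closure but \<open>z\<close>, between them, does not. The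
rescaled image \<open>S m\<close> of the unit square under the \<open>m\<close>-th iterate differs from \<open>K_set m F\<close> by at
most \<open>sqrt 2 / m\<close>. For large \<open>m\<close> it is therefore a path-connected set that avoids a fixed ball about
\<open>z\<close> and has points close to \<open>u\<close> and to \<open>v\<close>. It is also disjoint from its translates by
\<open>(2 / m) *\<^sub>R t\<close> for every nonzero integer vector \<open>t\<close>. For \<open>t\<close> nearly parallel to \<open>v - u\<close> this contradicts
\<open>hole_not_bypassed\<close>.\<close>

lemma convex_closure_rotation_set:
  assumes F: "F \<in> torus_lifts" and ne: "rotation_set F \<noteq> {}"
    and K_near: "\<And>m x. m \<ge> 1 \<Longrightarrow> x \<in> K_set m F \<Longrightarrow> infdist x (rotation_set F) \<le> c / real m"
    and near_K: "\<And>m v. m \<ge> 1 \<Longrightarrow> v \<in> rotation_set F \<Longrightarrow> infdist v (K_set m F) \<le> c / real m"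
  shows "convex (closure (rotation_set F))"
  unfolding convex_contains_open_segment
proof (intro ballI subsetI, rule ccontr)
  let ?A = "closure (rotation_set F)"
  fix u v z assume uv: "u \<in> ?A" "v \<in> ?A" and z: "z \<in> open_segment u v" "z \<notin> ?A"
  from z(1) obtain a where a: "0 < a" "a < 1" "z = (1 - a) *\<^sub>R u + a *\<^sub>R v" and "u \<noteq> v"
    by (auto simp: in_segment)
  define w where "w = v - u"
  define r where "r = infdist z ?A / 2"
  have "w \<noteq> 0" using \<open>u \<noteq> v\<close> by (simp add: w_def)
  have "infdist z ?A \<noteq> 0"
    using ne z(2) in_closure_iff_infdist_zero[of ?A z] by simp
  then have "r > 0" using infdist_nonneg[of z ?A] by (simp add: r_def)
  have uz: "u - z = (- a) *\<^sub>R w" and vz: "v - z = (1 - a) *\<^sub>R w"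
    by (simp_all add: a(3) w_def algebra_simps)

  \<comment> \<open>This is the component of \<open>y - z\<close> normal to \<open>d\<close>, multiplied by \<open>norm d\<close>.\<close>
  let ?side = "\<lambda>(d::real^2) (y::real^2). d $ 1 * (y - z) $ 2 - d $ 2 * (y - z) $ 1"
  \<comment> \<open>The conditions are open and hold for \<open>w\<close> itself, which has the line
    through \<open>u\<close>, \<open>z\<close>, \<open>v\<close> as its direction, and they are
    invariant under scaling. So they hold for an integer multiple of a rational approximation of
    \<open>w\<close>.\<close>
  have "\<exists>t\<in>integer_points. t \<noteq> 0 \<and> t \<bullet> (u - z) < 0 \<and> 0 < t \<bullet> (v - z)
      \<and> \<bar>?side t u\<bar> < r / 3 * norm t \<and> \<bar>?side t v\<bar> < r / 3 * norm t"
  proof -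
    define D where "D m = (\<chi> i. real_of_int \<lfloor>real m * w $ i\<rfloor>) /\<^sub>R real m" for m
    have D: "D \<longlonglongrightarrow> w"
      unfolding D_def by (rule floor_multiples_tendsto)
    have "w \<bullet> w > 0" using \<open>w \<noteq> 0\<close> by simp
    then have "w \<bullet> (u - z) < 0" "0 < w \<bullet> (v - z)"
      unfolding uz vz using a(1,2) by simp_all
    then have ev1: "\<forall>\<^sub>F m in sequentially. D m \<bullet> (u - z) < 0"
      and ev2: "\<forall>\<^sub>F m in sequentially. 0 < D m \<bullet> (v - z)"
      by (auto intro!: order_tendstoD[OF tendsto_inner[OF D tendsto_const]])
    have lim: "(\<lambda>m. r / 3 * norm (D m) - \<bar>?side (D m) y\<bar>) \<longlonglongrightarrow> r / 3 * norm w - \<bar>?side w y\<bar>" for y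
      by (intro tendsto_intros D)
    have pos: "r / 3 * norm w - \<bar>?side w y\<bar> > 0" if "y = u \<or> y = v" for y
    proof -
      have "?side w u = 0" "?side w v = 0"
        unfolding uz vz by simp_all
      then show ?thesis using that \<open>r > 0\<close> \<open>w \<noteq> 0\<close> by auto
    qed
    have ev3: "\<forall>\<^sub>F m in sequentially. r / 3 * norm (D m) - \<bar>?side (D m) y\<bar> > 0"
      if "y = u \<or> y = v" for y
      using lim pos[OF that] by (rule order_tendstoD(1))
    have "\<forall>\<^sub>F m in sequentially. m > 0 \<and> D m \<bullet> (u - z) < 0 \<and> 0 < D m \<bullet> (v - z)
      \<and> r / 3 * norm (D m) - \<bar>?side (D m) u\<bar> > 0 \<and> r / 3 * norm (D m) - \<bar>?side (D m) v\<bar> > 0"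
      by (intro eventually_conj eventually_gt_at_top ev1 ev2 ev3) simp_all
    then obtain m where m: "m > 0" "D m \<bullet> (u - z) < 0" "0 < D m \<bullet> (v - z)"
      "\<bar>?side (D m) u\<bar> < r / 3 * norm (D m)" "\<bar>?side (D m) v\<bar> < r / 3 * norm (D m)"
      using eventually_happens[of _ sequentially] by (auto simp: trivial_limit_sequentially)
    define t where "t = real m *\<^sub>R D m"
    have side: "?side t y = real m * ?side (D m) y" for y
      by (simp add: t_def algebra_simps)
    have side_t: "\<bar>?side t y\<bar> < r / 3 * norm t" if "\<bar>?side (D m) y\<bar> < r / 3 * norm (D m)" for y
    proof -
      have "\<bar>?side t y\<bar> = real m * \<bar>?side (D m) y\<bar>"
        unfolding side by (simp add: abs_mult)
      also have "\<dots> < real m * (r / 3 * norm (D m))"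
        using that m(1) by (intro mult_strict_left_mono) auto
      finally show ?thesis by (simp add: t_def mult_ac)
    qed
    have signs: "t \<bullet> (u - z) < 0" "0 < t \<bullet> (v - z)"
      using m by (simp_all add: t_def mult_pos_neg)
    have t: "t \<in> integer_points"
      using m(1) by (simp add: t_def D_def integer_points_def)
    have "t \<noteq> 0" using signs(1) by auto
    with signs side_t[OF m(4)] side_t[OF m(5)] show ?thesis
      by (intro bexI[OF _ t] conjI)
  qed
  then obtain t where t: "t \<in> integer_points" "t \<noteq> 0" "t \<bullet> (u - z) < 0" "0 < t \<bullet> (v - z)"
    "\<bar>?side t u\<bar> < r / 3 * norm t" "\<bar>?side t v\<bar> < r / 3 * norm t"
    by blast

  define C where "C = c + sqrt 2"
  define S where "S m = (\<lambda>x. (F ^^ m) x /\<^sub>R real m) ` cbox 0 1" for m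
  have S_K: "dist ((F ^^ m) x /\<^sub>R real m) (((F ^^ m) x - x) /\<^sub>R real m) \<le> sqrt 2 / real m"
    if "x \<in> cbox 0 1" for m x
  proof -
    have "dist ((F ^^ m) x /\<^sub>R real m) (((F ^^ m) x - x) /\<^sub>R real m) = norm x / real m"
      by (simp add: dist_norm flip: scaleR_diff_right) (simp add: divide_inverse mult.commute)
    then show ?thesis
      using norm_unit_square_le[OF that] by (simp add: divide_right_mono)
  qed
  have S_near: "infdist y ?A \<le> C / real m" if "m \<ge> 1" "y \<in> S m" for m y
  proof -
    from that(2) obtain x where x: "x \<in> cbox 0 1" "y = (F ^^ m) x /\<^sub>R real m"
      by (auto simp: S_def)
    then have "infdist (((F ^^ m) x - x) /\<^sub>R real m) (rotation_set F) \<le> c / real m"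
      using that(1) by (intro K_near) (auto simp: K_set_def)
    then have "infdist (((F ^^ m) x - x) /\<^sub>R real m) ?A \<le> c / real m"
      using infdist_mono[OF closure_subset ne] order.trans by blast
    then show ?thesis
      using infdist_triangle[of y ?A "((F ^^ m) x - x) /\<^sub>R real m"] S_K[OF x(1), of m]
      unfolding x(2) C_def by (simp add: add_divide_distrib)
  qed
  have near_S: "\<exists>x\<in>S m. dist y x \<le> C / real m" if "m \<ge> 1" "y \<in> ?A" for m y
  proof -
    have "compact (K_set m F)"
      unfolding K_set_def
      by (intro compact_continuous_image continuous_intros torus_lift_continuous[OF torus_lift_funpow[OF F]])
        (auto intro: continuous_intros)
    then obtain k where k: "k \<in> K_set m F" "infdist y (K_set m F) = dist y k"
      using infdist_attains_inf[OF compact_imp_closed K_set_nonempty] by blast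
    have "?A \<subseteq> {y. infdist y (K_set m F) \<le> c / real m}"
      using near_K that(1)
      by (intro closure_minimal closed_Collect_le continuous_intros) auto
    then have "dist y k \<le> c / real m" using k(2) that(2) by auto
    moreover from k(1) obtain x where "x \<in> cbox 0 1" "k = ((F ^^ m) x - x) /\<^sub>R real m"
      by (auto simp: K_set_def)
    ultimately show ?thesis
      using S_K[of x m] dist_triangle2[of y "(F ^^ m) x /\<^sub>R real m" k]
      by (intro bexI[of _ "(F ^^ m) x /\<^sub>R real m"]) (auto simp: S_def C_def add_divide_distrib)
  qed
  have to_0: "(\<lambda>m. B / real m) \<longlonglongrightarrow> 0" for B
    by (rule lim_const_over_n)
  have approx: "\<exists>Y. (\<forall>m\<ge>1. Y m \<in> S m) \<and> Y \<longlonglongrightarrow> y" if y: "y \<in> ?A" for y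
  proof -
    obtain Y where Y: "\<And>m. m \<ge> 1 \<Longrightarrow> Y m \<in> S m \<and> dist y (Y m) \<le> C / real m"
      using near_S[OF _ y] by metis
    have "(\<lambda>m. Y m - y) \<longlonglongrightarrow> 0"
      by (rule Lim_null_comparison[OF _ to_0[of C]])
        (use Y in \<open>auto simp: eventually_sequentially dist_norm norm_minus_commute intro!: exI[of _ 1]\<close>)
    then have "Y \<longlonglongrightarrow> y" by (simp add: LIM_zero_iff)
    with Y show ?thesis by blast
  qed
  obtain U V where U: "\<And>m. m \<ge> 1 \<Longrightarrow> U m \<in> S m" "U \<longlonglongrightarrow> u"
    and V: "\<And>m. m \<ge> 1 \<Longrightarrow> V m \<in> S m" "V \<longlonglongrightarrow> v"
    using approx[OF uv(1)] approx[OF uv(2)] by blast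
  have lim_in: "(\<lambda>m. t \<bullet> (U m - z)) \<longlonglongrightarrow> t \<bullet> (u - z)" "(\<lambda>m. t \<bullet> (V m - z)) \<longlonglongrightarrow> t \<bullet> (v - z)"
    "(\<lambda>m. \<bar>?side t (U m)\<bar>) \<longlonglongrightarrow> \<bar>?side t u\<bar>" "(\<lambda>m. \<bar>?side t (V m)\<bar>) \<longlonglongrightarrow> \<bar>?side t v\<bar>"
    by (intro tendsto_intros U V)+
  have "\<forall>\<^sub>F m in sequentially. m \<ge> 1 \<and> t \<bullet> (U m - z) < 0 \<and> 0 < t \<bullet> (V m - z)
      \<and> \<bar>?side t (U m)\<bar> < r / 3 * norm t \<and> \<bar>?side t (V m)\<bar> < r / 3 * norm t
      \<and> C / real m < r \<and> 2 * norm t / real m < r / 2"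
    by (intro eventually_conj eventually_ge_at_top order_tendstoD(1)[OF lim_in(2)] order_tendstoD(2)[OF lim_in(1)]
        order_tendstoD(2)[OF lim_in(3)] order_tendstoD(2)[OF lim_in(4)] order_tendstoD(2)[OF to_0])
      (use t \<open>r > 0\<close> in auto)
  then obtain m where m: "m \<ge> 1" "t \<bullet> (U m - z) < 0" "0 < t \<bullet> (V m - z)"
    "\<bar>?side t (U m)\<bar> < r / 3 * norm t" "\<bar>?side t (V m)\<bar> < r / 3 * norm t"
    "C / real m < r" "2 * norm t / real m < r / 2"
    using eventually_happens[of _ sequentially] by (auto simp: trivial_limit_sequentially)
  have Fm: "F ^^ m \<in> torus_lifts" using F by (rule torus_lift_funpow)
  show False
  proof (rule hole_not_bypassed[where S = "S m" and \<tau> = "2 / real m" and d = t and r = r and z = z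
        and u = "U m" and v = "V m"])
    show "path_connected (S m)"
      unfolding S_def
      by (intro path_connected_continuous_image continuous_intros torus_lift_continuous[OF Fm]
          convex_imp_path_connected convex_box)
    show "x + (2 / real m) *\<^sub>R t \<notin> S m" if "x \<in> S m" for x
    proof
      assume "x + (2 / real m) *\<^sub>R t \<in> S m"
      with that obtain a b where ab: "a \<in> cbox 0 1" "b \<in> cbox 0 1"
        "x = (F ^^ m) a /\<^sub>R real m" "x + (2 / real m) *\<^sub>R t = (F ^^ m) b /\<^sub>R real m"
        by (auto simp: S_def)
      from ab(3,4) have "real m *\<^sub>R ((F ^^ m) a /\<^sub>R real m + (2 / real m) *\<^sub>R t) = real m *\<^sub>R ((F ^^ m) b /\<^sub>R real m)"
        by simp
      then have "(F ^^ m) a + 2 *\<^sub>R t = (F ^^ m) b"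
        using m(1) by (simp add: scaleR_add_right)
      then show False
        using lift_image_disjoint_translate[OF Fm t(1,2), of "(F ^^ m) a"] ab(1,2) by auto
    qed
    show "r \<le> dist x z" if "x \<in> S m" for x
    proof -
      have "infdist z ?A = 2 * r" by (simp add: r_def)
      then show ?thesis
        using S_near[OF m(1) that] m(6) infdist_triangle[of z ?A x] dist_commute[of z x] by linarith
    qed
  qed (use m t U V in auto)
qed

section \<open>Mean displacement of pseudo-orbits\<close>

text \<open>The jump at step \<open>i\<close> is stretched by at most \<open>L\<close> in each of the remaining steps, and the resulting
bounds add up to a geometric series.\<close>

lemma pseudo_orbit_shadowing:
  assumes F: "L-lipschitz_on UNIV F" and L: "L > 1"
    and x: "\<And>i. i < m \<Longrightarrow> dist (F (x i)) (x (Suc i)) \<le> e"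
  shows "dist ((F ^^ m) (x 0)) (x m) \<le> e * ((L ^ m - 1) / (L - 1))"
  using x
proof (induction m)
  case (Suc m)
  have "dist ((F ^^ Suc m) (x 0)) (x (Suc m))
      \<le> dist (F ((F ^^ m) (x 0))) (F (x m)) + dist (F (x m)) (x (Suc m))"
    by (simp add: dist_triangle)
  also have "\<dots> \<le> L * (e * ((L ^ m - 1) / (L - 1))) + e"
  proof (rule add_mono)
    have "dist (F ((F ^^ m) (x 0))) (F (x m)) \<le> L * dist ((F ^^ m) (x 0)) (x m)"
      using F by (rule lipschitz_onD) auto
    also have "\<dots> \<le> L * (e * ((L ^ m - 1) / (L - 1)))"
      using Suc L by (intro mult_left_mono) auto
    finally show "dist (F ((F ^^ m) (x 0))) (F (x m)) \<le> L * (e * ((L ^ m - 1) / (L - 1)))" .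
  qed (use Suc in auto)
  also have "\<dots> = e * ((L ^ Suc m - 1) / (L - 1))"
    using L by (simp add: field_simps)
  finally show ?case .
qed simp

lemma average_near_convex:
  fixes A :: "'a::euclidean_space set"
  assumes A: "convex A" "closed A" "A \<noteq> {}" and q: "q > 0"
    and w: "\<And>j. j < q \<Longrightarrow> infdist (w j) A \<le> \<sigma>"
  shows "infdist ((\<Sum>j<q. w j) /\<^sub>R real q) A \<le> \<sigma>"
proof -
  have "\<exists>a\<in>A. infdist (w j) A = dist (w j) a" for j
    using infdist_attains_inf[OF A(2,3)] by metis
  then obtain a where a: "\<And>j. a j \<in> A" "\<And>j. infdist (w j) A = dist (w j) (a j)"
    by metis
  have "(\<Sum>j<q. (1 / real q) *\<^sub>R a j) \<in> A"
    using q a by (intro convex_sum[OF _ A(1)]) auto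
  then have in_A: "(\<Sum>j<q. a j) /\<^sub>R real q \<in> A"
    by (simp add: scaleR_sum_right divide_inverse)
  have "dist ((\<Sum>j<q. w j) /\<^sub>R real q) ((\<Sum>j<q. a j) /\<^sub>R real q) = norm (\<Sum>j<q. w j - a j) / real q"
    by (simp add: dist_norm sum_subtractf flip: scaleR_diff_right) (simp add: divide_inverse)
  also have "\<dots> \<le> (\<Sum>j<q. \<sigma>) / real q"
    using w a by (intro divide_right_mono order.trans[OF norm_sum] sum_mono) (auto simp flip: dist_norm)
  also have "\<dots> = \<sigma>" using q by simp
  finally show ?thesis by (rule infdist_le2[OF in_A])
qed

text \<open>Cut the pseudo-orbit into \<open>q = n div k\<close> blocks of length \<open>k\<close> and a rest of length \<open>r = n mod k\<close>. By
shadowing, the mean displacement over each block lies within \<open>step_error c L \<epsilon> k\<close> of the closure of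
the rotation set. By convexity, so does the mean \<open>p\<close> over all blocks; let \<open>v\<close> be a nearest point to
\<open>p\<close>. In the comparison of \<open>x n / n\<close> with \<open>v\<close>, the starting point costs \<open>sqrt 2 / n\<close>, the rest of the
pseudo-orbit at most \<open>r / n * (M + 2 * \<epsilon>)\<close>, where \<open>M\<close> is the maximal displacement, and replacing the
weight \<open>1 - r / n\<close> of \<open>v\<close> by 1 at most \<open>r / n * M\<close>.\<close>

lemma pseudo_orbit_near_rotation_set:
  assumes F: "F \<in> torus_lifts" and lip: "L-lipschitz_on UNIV F" and L: "L > 1"
    and ne: "rotation_set F \<noteq> {}"
    and conv: "convex (closure (rotation_set F))"
    and K_set_nonemptyar: "\<And>x. x \<in> K_set k F \<Longrightarrow> infdist x (rotation_set F) \<le> c / real k"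
    and x0: "x 0 \<in> cbox 0 1"
    and x: "\<And>i. i < n \<Longrightarrow> dist (F (x i)) (x (Suc i)) \<le> 2 * \<epsilon>"
    and k: "1 \<le> k" "k \<le> n"
  shows "infdist (x n /\<^sub>R real n) (rotation_set F) \<le> sqrt 2 / real n +
    (2 * real (n mod k) / real n * (max_displacement F + \<epsilon>) +
     (1 - real (n mod k) / real n) * step_error c L \<epsilon> k)"
proof -
  let ?A = "closure (rotation_set F)" and ?M = "max_displacement F"
  define q where "q = n div k"
  define r where "r = n mod k"
  have n: "n = q * k + r" "n > 0" by (use k in \<open>simp_all add: q_def r_def\<close>)
  have "q > 0" using k by (simp add: q_def div_greater_zero_iff)
  have block: "infdist ((x (Suc j * k) - x (j * k)) /\<^sub>R real k) ?A \<le> step_error c L \<epsilon> k" if "j < q" for j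
  proof -
    have "Suc j * k \<le> q * k" using that by (intro mult_le_mono1) simp
    then have "j * k + k \<le> n" using n by simp
    then have shadow: "dist ((F ^^ k) (x (j * k))) (x (j * k + k)) \<le> 2 * \<epsilon> * ((L ^ k - 1) / (L - 1))"
      using pseudo_orbit_shadowing[OF lip L, of k "\<lambda>i. x (j * k + i)" "2 * \<epsilon>"] x by simp
    define y where "y = ((F ^^ k) (x (j * k)) - x (j * k)) /\<^sub>R real k"
    obtain b where b: "b \<in> cbox 0 1" "(F ^^ k) (x (j * k)) - x (j * k) = (F ^^ k) b - b"
      using torus_lift_displacement[OF torus_lift_funpow[OF F]] by blast
    then have "y \<in> K_set k F" by (auto simp: K_set_def y_def)
    then have "infdist y ?A \<le> c / real k"
      using K_set_nonemptyar infdist_mono[OF closure_subset ne, of y] by fastforce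
    moreover have "dist ((x (Suc j * k) - x (j * k)) /\<^sub>R real k) y
        = dist ((F ^^ k) (x (j * k))) (x (j * k + k)) / real k"
      unfolding y_def by (simp add: dist_norm norm_minus_commute add.commute flip: scaleR_diff_right)
        (simp add: divide_inverse mult.commute)
    ultimately have "infdist ((x (Suc j * k) - x (j * k)) /\<^sub>R real k) ?A
        \<le> c / real k + 2 * \<epsilon> * ((L ^ k - 1) / (L - 1)) / real k"
      using infdist_triangle[of "(x (Suc j * k) - x (j * k)) /\<^sub>R real k" ?A y] divide_right_mono[OF shadow, of "real k"]
      by simp
    then show ?thesis by (simp add: step_error_def add_divide_distrib)
  qed
  define p where "p = (x (q * k) - x 0) /\<^sub>R (real q * real k)"
  have "infdist ((\<Sum>j<q. (x (Suc j * k) - x (j * k)) /\<^sub>R real k) /\<^sub>R real q) ?A \<le> step_error c L \<epsilon> k"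
    using ne \<open>q > 0\<close> block by (intro average_near_convex conv) auto
  also have "(\<Sum>j<q. (x (Suc j * k) - x (j * k)) /\<^sub>R real k) /\<^sub>R real q = p"
    using sum_lessThan_telescope[of "\<lambda>j. x (j * k)" q]
    by (simp add: p_def flip: scaleR_sum_right)
  finally have "infdist p ?A \<le> step_error c L \<epsilon> k" .
  moreover obtain v where "v \<in> ?A" "infdist p ?A = dist p v"
    using infdist_attains_inf[OF closed_closure, of "rotation_set F" p] ne by (metis closure_eq_empty)
  ultimately have v: "v \<in> ?A" "dist p v \<le> step_error c L \<epsilon> k" by simp_all
  have tail: "norm (x n - x (q * k)) \<le> real r * (?M + 2 * \<epsilon>)"
    using pseudo_orbit_displacement_le[OF F, of r "\<lambda>i. x (q * k + i)" "2 * \<epsilon>"] x by (simp add: n(1))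
  have qk: "real q * real k = real n - real r" "real q * real k \<noteq> 0"
    using n(1) \<open>q > 0\<close> k by simp_all
  then have frac: "1 - real r / real n = real q * real k / real n"
    using n(2) by (simp add: diff_divide_distrib)
  have p: "(real q * real k) *\<^sub>R p = x (q * k) - x 0"
    by (simp only: p_def scaleR_scaleR right_inverse[OF qk(2)] scaleR_one)
  have "(real q * real k) *\<^sub>R v = real n *\<^sub>R v - real r *\<^sub>R v"
    by (simp only: qk(1) scaleR_diff_left)
  then have split: "x n - real n *\<^sub>R v
      = x 0 + (x n - x (q * k)) + (real q * real k) *\<^sub>R (p - v) - real r *\<^sub>R v"
    unfolding scaleR_diff_right p by simp
  have "norm (x n - real n *\<^sub>R v) \<le> norm (x 0) + norm (x n - x (q * k))
      + norm ((real q * real k) *\<^sub>R (p - v)) + norm (real r *\<^sub>R v)"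
    unfolding split
    using norm_triangle_ineq4[of "x 0 + (x n - x (q * k)) + (real q * real k) *\<^sub>R (p - v)" "real r *\<^sub>R v"]
      norm_triangle_ineq[of "x 0 + (x n - x (q * k))" "(real q * real k) *\<^sub>R (p - v)"]
      norm_triangle_ineq[of "x 0" "x n - x (q * k)"] by linarith
  also have "\<dots> \<le> sqrt 2 + real r * (?M + 2 * \<epsilon>) + real q * real k * step_error c L \<epsilon> k + real r * ?M"
  proof (intro add_mono)
    show "norm (x 0) \<le> sqrt 2" using x0 by (rule norm_unit_square_le)
    show "norm (x n - x (q * k)) \<le> real r * (?M + 2 * \<epsilon>)" by (rule tail)
    have "norm ((real q * real k) *\<^sub>R (p - v)) = real q * real k * dist p v"
      by (simp add: dist_norm)
    also have "\<dots> \<le> real q * real k * step_error c L \<epsilon> k"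
      using v(2) by (rule mult_left_mono) simp
    finally show "norm ((real q * real k) *\<^sub>R (p - v)) \<le> real q * real k * step_error c L \<epsilon> k" .
    show "norm (real r *\<^sub>R v) \<le> real r * ?M"
      using norm_rotation_vector_le[OF F v(1)] by (simp add: mult_left_mono)
  qed
  finally have "norm (x n - real n *\<^sub>R v) / real n
      \<le> (sqrt 2 + real r * (?M + 2 * \<epsilon>) + real q * real k * step_error c L \<epsilon> k + real r * ?M) / real n"
    by (rule divide_right_mono) simp
  also have "\<dots> = sqrt 2 / real n + (2 * real r / real n * (?M + \<epsilon>)
      + (1 - real r / real n) * step_error c L \<epsilon> k)"
    unfolding frac by (simp add: add_divide_distrib[symmetric]) (simp add: algebra_simps)
  also have "norm (x n - real n *\<^sub>R v) / real n = dist (x n /\<^sub>R real n) v"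
  proof -
    have "x n /\<^sub>R real n - v = (x n - real n *\<^sub>R v) /\<^sub>R real n"
      using n(2) by (simp add: scaleR_diff_right)
    then show ?thesis by (simp add: dist_norm divide_inverse mult.commute)
  qed
  finally have "infdist (x n /\<^sub>R real n) ?A \<le> sqrt 2 / real n + (2 * real r / real n * (?M + \<epsilon>)
      + (1 - real r / real n) * step_error c L \<epsilon> k)"
    using infdist_le2[OF v(1)] by blast
  moreover have "infdist (x n /\<^sub>R real n) (rotation_set F) = infdist (x n /\<^sub>R real n) ?A"
    by (simp add: infdist_eq_setdist)
  ultimately show ?thesis by (simp add: r_def)
qed

section \<open>Box iterates, orbits and pseudo-orbits\<close>

lemma initial_boxes_subset_all_boxes: "\<B>0 \<subseteq> all_boxes \<B>0"
proof
  fix B assume "B \<in> \<B>0"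
  moreover have "B = (+) 0 ` B" "0 \<in> integer_points"
    by (auto simp: integer_points_def)
  ultimately show "B \<in> all_boxes \<B>0"
    unfolding all_boxes_def by blast
qed

lemma all_boxes_cover_plane:
  assumes "initial_boxes \<epsilon> \<B>0"
  obtains B where "B \<in> all_boxes \<B>0" "y \<in> B"
proof -
  obtain t where t: "t \<in> integer_points" "y - t \<in> cbox 0 1"
    by (rule integer_translate_in_unit_square)
  with assms obtain B where "B \<in> \<B>0" "y - t \<in> B"
    unfolding initial_boxes_def by blast
  with t(1) have "(+) t ` B \<in> all_boxes \<B>0" "y \<in> (+) t ` B"
    by (auto simp: all_boxes_def image_iff intro: bexI[of _ "y - t"])
  then show ?thesis by (rule that)
qed

lemma box_dist_le:
  assumes "initial_boxes \<epsilon> \<B>0" "B \<in> all_boxes \<B>0" "x \<in> B" "y \<in> B"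
  shows "dist x y \<le> \<epsilon>"
proof -
  from assms(2) obtain B' t where "B' \<in> \<B>0" "B = (+) t ` B'"
    by (auto simp: all_boxes_def)
  with assms obtain x' y' where "x' \<in> B'" "y' \<in> B'" "dist x y = dist x' y'"
    by auto
  moreover have "bounded B'" "diameter B' \<le> \<epsilon>"
    using assms(1) \<open>B' \<in> \<B>0\<close> by (auto simp: initial_boxes_def compact_imp_bounded)
  ultimately show ?thesis
    using diameter_bounded_bound[of B' x' y'] by simp
qed

lemma box_closed:
  assumes "initial_boxes \<epsilon> \<B>0" "B \<in> all_boxes \<B>0"
  shows "closed B"
  using assms
  by (auto simp: all_boxes_def initial_boxes_def compact_imp_closed closed_translation)

lemma box_iterate_subset: "box_iterate F R \<B>0 \<Gamma> m \<subseteq> all_boxes \<B>0"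
  by (cases m) (auto intro: initial_boxes_subset_all_boxes[THEN subsetD])

text \<open>Each step of the algorithm moves from the image of a sample point to a box at distance at most \<open>R\<close>,
and then to some point of this box; the second move covers at most \<open>\<epsilon>\<close>, the bound on diameters. So an arbitrary
point of the final box may be taken as the end of the pseudo-orbit.\<close>

lemma Q_set_pseudo_orbit:
  assumes boxes: "initial_boxes \<epsilon> \<B>0" and samples: "box_samples \<eta> \<B>0 \<Gamma>" and "R \<le> \<epsilon>"
    and y: "y \<in> Q_set F R \<B>0 \<Gamma> m"
  shows "\<exists>x. x 0 \<in> cbox 0 1 \<and> x m = y \<and> (\<forall>i<m. dist (F (x i)) (x (Suc i)) \<le> 2 * \<epsilon>)"
  using y
proof (induction m arbitrary: y)
  case 0
  then show ?case
    using boxes by (intro exI[of _ "\<lambda>_. y"]) (auto simp: Q_set_def initial_boxes_def)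
next
  case (Suc m)
  then obtain B B' a where B: "y \<in> B'" "B' \<in> all_boxes \<B>0" "B \<in> box_iterate F R \<B>0 \<Gamma> m"
    "a \<in> \<Gamma> B" "infdist (F a) B' \<le> R"
    by (auto simp: Q_set_def box_image_def)
  have "a \<in> B"
    using samples B(3,4) box_iterate_subset by (fastforce simp: box_samples_def)
  then have "a \<in> Q_set F R \<B>0 \<Gamma> m" using B(3) by (auto simp: Q_set_def)
  from Suc.IH[OF this] obtain x where x: "x 0 \<in> cbox 0 1" "x m = a"
    "\<forall>i<m. dist (F (x i)) (x (Suc i)) \<le> 2 * \<epsilon>" by blast
  obtain z where z: "z \<in> B'" "infdist (F a) B' = dist (F a) z"
    using infdist_attains_inf[OF box_closed[OF boxes B(2)], of "F a"] B(1) by blast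
  have "dist (F a) y \<le> 2 * \<epsilon>"
    using dist_triangle[of "F a" y z] box_dist_le[OF boxes B(2) z(1) B(1)] z(2) B(5) \<open>R \<le> \<epsilon>\<close> by linarith
  then show ?case
    using x by (intro exI[of _ "x(Suc m := y)"]) (auto simp: less_Suc_eq)
qed

text \<open>The algorithm never loses a true orbit: a sample point within \<open>\<eta>\<close> of the current point has its image
within \<open>\<eta> * L \<le> R\<close> of the next one, so every box that contains the next point is selected.\<close>

lemma funpow_image_subset_Q_set:
  assumes lip: "L-lipschitz_on UNIV F" and boxes: "initial_boxes \<epsilon> \<B>0"
    and samples: "box_samples \<eta> \<B>0 \<Gamma>" and "\<eta> * L \<le> R" and x: "x \<in> cbox 0 1"
  shows "(F ^^ m) x \<in> Q_set F R \<B>0 \<Gamma> m"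
proof (induction m)
  case 0
  then show ?case using boxes x by (simp add: Q_set_def initial_boxes_def)
next
  case (Suc m)
  let ?w = "(F ^^ m) x"
  from Suc obtain B where B: "B \<in> box_iterate F R \<B>0 \<Gamma> m" "?w \<in> B"
    by (auto simp: Q_set_def)
  have "B \<in> all_boxes \<B>0" using B(1) box_iterate_subset by blast
  then obtain a where a: "a \<in> \<Gamma> B" "dist ?w a \<le> \<eta>"
    using samples B(2) unfolding box_samples_def by blast
  obtain B' where B': "B' \<in> all_boxes \<B>0" "F ?w \<in> B'"
    using boxes by (rule all_boxes_cover_plane)
  have "dist (F a) (F ?w) \<le> L * dist a ?w"
    using lip by (rule lipschitz_onD) auto
  also have "\<dots> \<le> L * \<eta>"
    using a(2) lipschitz_on_nonneg[OF lip] by (intro mult_left_mono) (simp_all add: dist_commute)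
  finally have "infdist (F a) B' \<le> R"
    using infdist_le[OF B'(2), of "F a"] \<open>\<eta> * L \<le> R\<close> by (simp add: mult.commute)
  then have "B' \<in> box_image F R \<B>0 \<Gamma> B"
    using a(1) B' by (auto simp: box_image_def)
  then show ?case
    using B(1) B' by (auto simp: Q_set_def)
qed

section \<open>The error bound\<close>

text \<open>The weight \<open>1 - (n mod k) / n\<close> equals \<open>(n div k) * k / n\<close>, so the second summand is at least
\<open>(n div k) * c / n\<close>. Hence the bound for points of the box iterate also covers the distance \<open>c / n\<close>
from the rotation set to \<open>K_set n F\<close>.\<close>

lemma averaged_error_ge:
  fixes c E M :: real
  assumes k: "1 \<le> k" "k \<le> n" and "c > 0" "E \<ge> 0" "M \<ge> 0"
  shows "c / real n \<le> 2 * real (n mod k) / real n * M + (1 - real (n mod k) / real n) * (1 / real k * (c + E))"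
proof -
  have n: "real n = real (n div k) * real k + real (n mod k)"
    by (metis div_mult_mod_eq of_nat_add of_nat_mult)
  have "n div k \<ge> 1" using k by (simp add: Suc_le_eq div_greater_zero_iff)
  then have "c * 1 \<le> (c + E) * real (n div k)"
    using assms by (intro mult_mono) auto
  then have "c / real n \<le> (c + E) * real (n div k) / real n"
    by (intro divide_right_mono) auto
  also have "\<dots> = (1 - real (n mod k) / real n) * (1 / real k * (c + E))"
  proof -
    have "1 - real (n mod k) / real n = real (n div k) * real k / real n"
      using n k by (simp add: field_simps)
    then show ?thesis using k by simp
  qed
  also have "\<dots> \<le> 2 * real (n mod k) / real n * M + \<dots>"
    using assms by simp
  finally show ?thesis .
qed

theorem theorem14:
  fixes F :: "real^2 \<Rightarrow> real^2"
    and L \<epsilon> \<eta> R c :: real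
    and n k\<^sub>n :: nat
    and \<B>0 :: "(real^2) set set"
    and \<Gamma> :: "(real^2) set \<Rightarrow> (real^2) set"
  assumes "F \<in> torus_lifts"
    and "L > 1"
    and "L-lipschitz_on UNIV F"
    and "\<epsilon> > 0" and "\<eta> > 0" and "R > 0"
    and "\<eta> * L \<le> R" and "R \<le> \<epsilon>"
    and "n \<ge> 1"
    and "c > 0"
    and "\<And>k::nat. k \<ge> 1 \<Longrightarrow> hausdorff_dist (K_set k F) (rotation_set F) \<le> ennreal (c / real k)"
    and "initial_boxes \<epsilon> \<B>0"
    and "box_samples \<eta> \<B>0 \<Gamma>"
    and "is_arg_min (step_error c L \<epsilon>) (\<lambda>k. 1 \<le> k \<and> k \<le> n) k\<^sub>n"
  shows "hausdorff_dist (Q_star F R \<B>0 \<Gamma> n) (rotation_set F)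
    \<le> ennreal (max (2 * sqrt 2 / real n) (sqrt 2 / real n + gamma_bound F c L \<epsilon> n k\<^sub>n))"
proof -
  note F = assms(1) and L = assms(2) and lip = assms(3) and boxes = assms(12) and samples = assms(13)
  have ne: "rotation_set F \<noteq> {}"
    using assms(11)[of 1] hausdorff_dist_empty_right[OF K_set_nonempty, of 1] by (auto simp: top_unique)
  have K_set_nonemptyar: "infdist x (rotation_set F) \<le> c / real m" if "m \<ge> 1" "x \<in> K_set m F" for m x
    using assms(11)[OF that(1)] that(2) \<open>c > 0\<close> by (simp add: hausdorff_dist_le_iff[OF K_set_nonempty ne])
  have near_K: "infdist v (K_set m F) \<le> c / real m" if "m \<ge> 1" "v \<in> rotation_set F" for m v
    using assms(11)[OF that(1)] that(2) \<open>c > 0\<close> by (simp add: hausdorff_dist_le_iff[OF K_set_nonempty ne])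
  have conv: "convex (closure (rotation_set F))"
    using F ne K_set_nonemptyar near_K by (rule convex_closure_rotation_set)
  have k: "1 \<le> k\<^sub>n" "k\<^sub>n \<le> n" and k_min: "\<And>j. 1 \<le> j \<Longrightarrow> j \<le> n \<Longrightarrow> step_error c L \<epsilon> k\<^sub>n \<le> step_error c L \<epsilon> j"
    using assms(14) by (auto simp: is_arg_min_linorder)
  have "(MIN j\<in>{1..n}. step_error c L \<epsilon> j) = step_error c L \<epsilon> k\<^sub>n"
    by (rule Min_eqI) (use k k_min in auto)
  then have gamma: "gamma_bound F c L \<epsilon> n k\<^sub>n =
      2 * real (n mod k\<^sub>n) / real n * (max_displacement F + \<epsilon>) +
      (1 - real (n mod k\<^sub>n) / real n) * step_error c L \<epsilon> k\<^sub>n"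
    by (simp add: gamma_bound_def)
  have "0 \<le> max_displacement F"
    using norm_displacement_le[OF F, of 0] norm_ge_zero order.trans by blast
  then have gamma_ge: "c / real n \<le> gamma_bound F c L \<epsilon> n k\<^sub>n"
    unfolding gamma step_error_def using k assms(4,10) L by (intro averaged_error_ge) auto

  let ?Q = "Q_star F R \<B>0 \<Gamma> n" and ?bound = "sqrt 2 / real n + gamma_bound F c L \<epsilon> n k\<^sub>n"
  have Q_near: "infdist y (rotation_set F) \<le> ?bound" if "y \<in> ?Q" for y
  proof -
    from that obtain q where q: "q \<in> Q_set F R \<B>0 \<Gamma> n" "y = q /\<^sub>R real n"
      by (auto simp: Q_star_def)
    obtain x where "x 0 \<in> cbox 0 1" "x n = q" "\<And>i. i < n \<Longrightarrow> dist (F (x i)) (x (Suc i)) \<le> 2 * \<epsilon>"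
      using Q_set_pseudo_orbit[OF boxes samples assms(8) q(1)] by blast
    then show ?thesis
      using pseudo_orbit_near_rotation_set[OF F lip L ne conv K_set_nonemptyar[OF k(1)] _ _ k, of x \<epsilon>]
      unfolding gamma q(2) by simp
  qed
  \<comment> \<open>The box iterate contains the image of the unit square under the
    \<open>n\<close>-th iterate of \<open>F\<close>, whose rescaling is within
    \<open>sqrt 2 / n\<close> of \<open>K_set n F\<close>.\<close>
  have near_Q: "infdist v ?Q \<le> ?bound" if "v \<in> rotation_set F" for v
  proof -
    have "infdist y ?Q \<le> sqrt 2 / real n" if "y \<in> K_set n F" for y
    proof -
      from that obtain x where x: "x \<in> cbox 0 1" "y = ((F ^^ n) x - x) /\<^sub>R real n"
        by (auto simp: K_set_def)
      have "(F ^^ n) x /\<^sub>R real n \<in> ?Q"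
        using funpow_image_subset_Q_set[OF lip boxes samples assms(7) x(1)] by (auto simp: Q_star_def)
      moreover have "dist y ((F ^^ n) x /\<^sub>R real n) = norm x / real n"
        by (simp add: x(2) dist_norm flip: scaleR_diff_right) (simp add: divide_inverse mult.commute)
      ultimately show ?thesis
        using norm_unit_square_le[OF x(1)] by (auto intro!: infdist_le2 divide_right_mono)
    qed
    then have K_Q: "infdist v ?Q - sqrt 2 / real n \<le> dist v y" if "y \<in> K_set n F" for y
      using infdist_triangle[of v ?Q y] that by fastforce
    have "infdist v ?Q - sqrt 2 / real n \<le> infdist v (K_set n F)"
      unfolding infdist_notempty[OF K_set_nonempty] using K_set_nonempty K_Q by (rule cINF_greatest)
    then show ?thesis
      using near_K[OF assms(9) that] gamma_ge by linarith
  qed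
  have "?Q \<noteq> {}"
    using funpow_image_subset_Q_set[OF lip boxes samples assms(7), of 0 n]
    by (auto simp: Q_star_def mem_box_cart)
  moreover have "0 \<le> ?bound"
    using gamma_ge assms(10) by (smt (verit) divide_nonneg_nonneg of_nat_0_le_iff real_sqrt_ge_zero)
  ultimately have "hausdorff_dist ?Q (rotation_set F) \<le> ennreal ?bound"
    using Q_near near_Q ne by (simp add: hausdorff_dist_le_iff)
  also have "\<dots> \<le> ennreal (max (2 * sqrt 2 / real n) ?bound)"
    by (intro ennreal_leI) simp
  finally show ?thesis .
qed

end
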